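(* Let $X$ be a non-negative random variable with absolutely continuous distribution. The past extropy $t\mapsto J({}_tX)$ of $X$ is uniquely determined by its reversed failure rate $t\mapsto\tau(t)$; that is, if $X$ and $Y$ are two non-negative random variables with absolutely continuous distributions and the same reversed failure rate function, then $J({}_tX)=J({}_tY)$ for all $t>0$ at which these are defined.
   Context: For a non-negative random variable $X$ with absolutely continuous cumulative distribution function $F$ and density $f$, and for $t>0$ with $F(t)>0$, the past extropy of $X$ at time $t$ (the extropy of the past lifetime ${}_tX=(t-X\mid X<t)$) is $$J({}_tX)=-\frac{1}{2F^2(t)}\int_0^t f^2(x)\,\mathrm dx ,$$ and the reversed failure rate is $\tau(t)=\dfrac{f(t)}{F(t)}$. Two reversed failure rate functions being the same means they have the same domain of definition and agree on it. *)

theory Defs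
  imports "HOL-Probability.Probability"
begin

text \<open>
  The law of a random variable \<open>X\<close> on \<open>M\<close> is absolutely continuous with density \<open>f\<close> iff
  \<open>distributed M lborel X f\<close>. A density is determined only up to a null set, so the notions
  below take the chosen version \<open>f\<close> as an argument. Both are partial functions of \<open>t\<close>, defined
  exactly where \<open>t > 0\<close> and \<open>F(t) > 0\<close>; equality of such functions therefore
  includes equality of their domains.
\<close>

definition reversed_failure_rate ::
    "'a measure \<Rightarrow> ('a \<Rightarrow> real) \<Rightarrow> (real \<Rightarrow> real) \<Rightarrow> real \<rightharpoonup> real" where
  "reversed_failure_rate M X f t =
     (let F = cdf (distr M borel X)
      in if 0 < t \<and> 0 < F t then Some (f t / F t) else None)"

text \<open>
  The integral of \<open>f\<^sup>2\<close> may diverge even though \<open>f\<close> is integrable, so the past extropy takes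
  extended real values, \<open>-\<infinity>\<close> being the value in the divergent case.
\<close>

definition past_extropy ::
    "'a measure \<Rightarrow> ('a \<Rightarrow> real) \<Rightarrow> (real \<Rightarrow> real) \<Rightarrow> real \<rightharpoonup> ereal" where
  "past_extropy M X f t =
     (let F = cdf (distr M borel X)
      in if 0 < t \<and> 0 < F t
         then Some (ereal (- 1 / (2 * (F t)\<^sup>2)) *
                    enn2ereal (\<integral>\<^sup>+x\<in>{0..t}. ennreal ((f x)\<^sup>2) \<partial>lborel))
         else None)"

end

theory Submission
  imports Defs
begin

text \<open>
  If \<open>F\<close> and \<open>G\<close> have the same reversed failure rate, then \<open>f \<ge> g\<close> wherever \<open>F \<ge> G > 0\<close>. So once
  \<open>F > G\<close> at some point, the gap \<open>F - G\<close> can never shrink afterwards, which is impossible as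
  both functions tend to \<open>1\<close>. Hence \<open>F = G\<close>, the densities agree almost everywhere, and so do
  the past extropies.
\<close>

text \<open>The endpoint \<open>z\<close> is a null set for \<open>lborel\<close>, so a comparison
  on the open interval is enough. This matters later, when \<open>z\<close> is a first crossing
  point and nothing is yet known there.\<close>

lemma emeasure_density_Ioc_mono:
  fixes f g :: "real \<Rightarrow> ennreal"
  assumes [measurable]: "f \<in> borel_measurable borel" "g \<in> borel_measurable borel"
    and le: "\<And>t. x < t \<Longrightarrow> t < z \<Longrightarrow> g t \<le> f t"
  shows "emeasure (density lborel g) {x<..z} \<le> emeasure (density lborel f) {x<..z}"
proof -
  have "AE t in lborel. t \<noteq> z"
    by (rule AE_lborel_singleton)
  then have "AE t in lborel. g t * indicator {x<..z} t \<le> f t * indicator {x<..z} t"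
    by eventually_elim (auto simp: indicator_def intro: le)
  then show ?thesis
    by (simp add: emeasure_density nn_integral_mono_AE)
qed

text \<open>The increment of a cdf from \<open>x\<close> to \<open>z\<close> is the mass of
  \<open>{x<..z}\<close>, so the gap changes by the difference of the two masses.\<close>

lemma cdf_gap_mono:
  fixes f g :: "real \<Rightarrow> ennreal"
  assumes P: "real_distribution (density lborel f)" and Q: "real_distribution (density lborel g)"
    and [measurable]: "f \<in> borel_measurable borel" "g \<in> borel_measurable borel"
    and le: "\<And>t. x < t \<Longrightarrow> t < z \<Longrightarrow> g t \<le> f t"
    and "x \<le> z"
  shows "cdf (density lborel f) x - cdf (density lborel g) x
    \<le> cdf (density lborel f) z - cdf (density lborel g) z"
proof (cases "x = z")
  case False
  interpret P: real_distribution "density lborel f" by fact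
  interpret Q: real_distribution "density lborel g" by fact
  have "x < z" using False \<open>x \<le> z\<close> by simp
  have "measure (density lborel g) {x<..z} \<le> measure (density lborel f) {x<..z}"
    using emeasure_density_Ioc_mono[of f g x z] le
    by (simp add: P.emeasure_eq_measure Q.emeasure_eq_measure)
  then show ?thesis
    using P.cdf_diff_eq[OF \<open>x < z\<close>] Q.cdf_diff_eq[OF \<open>x < z\<close>] by linarith
qed simp

text \<open>A positive gap cannot vanish later: up to the first candidate point \<open>z\<close> it
  has only grown, and right continuity keeps it positive just after \<open>z\<close>. It therefore
  stays above its initial value, yet it must tend to 0.\<close>

lemma cdf_le_if_density_ge_where_above:
  fixes f g :: "real \<Rightarrow> ennreal"
  assumes P: "real_distribution (density lborel f)" and Q: "real_distribution (density lborel g)"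
    and meas: "f \<in> borel_measurable borel" "g \<in> borel_measurable borel"
    and le: "\<And>t. x \<le> t \<Longrightarrow> cdf (density lborel g) t < cdf (density lborel f) t \<Longrightarrow> g t \<le> f t"
  shows "cdf (density lborel f) x \<le> cdf (density lborel g) x"
proof (rule ccontr)
  interpret P: real_distribution "density lborel f" by fact
  interpret Q: real_distribution "density lborel g" by fact
  define D where "D t = cdf (density lborel f) t - cdf (density lborel g) t" for t
  assume "\<not> ?thesis"
  then have Dx: "0 < D x" by (simp add: D_def)
  \<comment> \<open>Positivity is asked only strictly before \<open>z\<close>, so that
    \<open>z\<close> may be the infimum of the points where \<open>D\<close> is not
    positive.\<close>
  have gap: "D x \<le> D z" if "x \<le> z" and "\<And>t. x \<le> t \<Longrightarrow> t < z \<Longrightarrow> 0 < D t" for z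
    unfolding D_def by (rule cdf_gap_mono[OF P Q meas]) (use that in \<open>auto simp: D_def intro!: le\<close>)
  have pos: "0 < D y" if "x \<le> y" for y
  proof (rule ccontr)
    assume "\<not> 0 < D y"
    define Z where "Z = {t. x \<le> t \<and> D t \<le> 0}"
    define z where "z = Inf Z"
    have Z: "Z \<noteq> {}" "bdd_below Z"
      using \<open>x \<le> y\<close> \<open>\<not> 0 < D y\<close> by (auto simp: Z_def intro!: bdd_belowI[of _ x])
    have "x \<le> z" unfolding z_def by (rule cInf_greatest) (use Z in \<open>auto simp: Z_def\<close>)
    have "0 < D t" if "x \<le> t" "t < z" for t
      using that cInf_lower[OF _ Z(2), of t] by (force simp: Z_def z_def)
    then have "0 < D z" using gap[OF \<open>x \<le> z\<close>] Dx by fastforce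
    \<comment> \<open>A cdf is right continuous, and points of \<open>Z\<close> can lie only at
      \<open>z\<close> or to its right.\<close>
    have "continuous (at_right z) D"
      unfolding D_def by (intro continuous_intros P.cdf_is_right_cont Q.cdf_is_right_cont)
    then have "(D \<longlongrightarrow> D z) (at_right z)" by (simp add: continuous_within)
    then have "\<forall>\<^sub>F t in at_right z. 0 < D t"
      using \<open>0 < D z\<close> by (rule order_tendstoD)
    then obtain b where b: "z < b" "\<And>t. z < t \<Longrightarrow> t < b \<Longrightarrow> 0 < D t"
      by (auto simp: eventually_at_right[OF less_add_one])
    \<comment> \<open>Since \<open>b\<close> exceeds the infimum of \<open>Z\<close>, some point of
      \<open>Z\<close> lies below \<open>b\<close>; but \<open>D\<close> is positive on all of
      \<open>z \<le> t < b\<close>.\<close>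
    obtain t where t: "t \<in> Z" "t < b"
      using b(1) cInf_less_iff[OF Z] by (auto simp: z_def)
    have "z \<le> t" unfolding z_def by (rule cInf_lower[OF t(1) Z(2)])
    then show False
      using b(2)[of t] t \<open>0 < D z\<close> by (cases "t = z") (auto simp: Z_def)
  qed
  \<comment> \<open>Both measures have total mass 1, so the gap tends to 0.\<close>
  have "(D \<longlongrightarrow> 1 - 1) at_top"
    unfolding D_def by (intro tendsto_diff P.cdf_lim_at_top_prob Q.cdf_lim_at_top_prob)
  moreover have "\<forall>\<^sub>F t in at_top. D x \<le> D t"
    using eventually_ge_at_top[of x] by eventually_elim (auto intro: gap pos)
  ultimately have "D x \<le> 1 - 1"
    by (intro tendsto_lowerbound) auto
  then show False using Dx by simp
qed

text \<open>Reversed failure rates carry no information at negative \<open>t\<close>; there the cdf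
  is fixed by the nonnegativity of \<open>X\<close>.\<close>

lemma cdf_eq_zero_if_AE_nonneg:
  assumes "AE \<omega> in M. 0 \<le> X \<omega>" and [measurable]: "X \<in> borel_measurable M" and "t < 0"
  shows "cdf (distr M borel X) t = 0"
proof -
  have "AE \<omega> in M. \<not> X \<omega> \<le> t"
    using assms(1) by eventually_elim (use \<open>t < 0\<close> in auto)
  then have "emeasure M {\<omega> \<in> space M. X \<omega> \<le> t} = 0"
    by (subst (asm) AE_iff_measurable[OF _ refl]) auto
  moreover have "X -` {..t} \<inter> space M = {\<omega> \<in> space M. X \<omega> \<le> t}" by auto
  ultimately show ?thesis by (simp add: cdf_def measure_def emeasure_distr)
qed

text \<open>\<open>distributed\<close> pushes forward to \<open>lborel\<close>, whereas cdfs are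
  taken over \<open>borel\<close>; both have the same measurable sets, so the image measures
  coincide.\<close>

lemma distr_borel_eq_density:
  assumes "distributed M lborel X f"
  shows "distr M borel X = density lborel f"
  using distributed_distr_eq_density[OF assms] distr_cong[of M M borel lborel X X] by simp

lemma real_distribution_distr_borel:
  assumes "prob_space M" "X \<in> borel_measurable M"
  shows "real_distribution (distr M borel X)"
  using assms
  by (simp add: real_distribution_def real_distribution_axioms_def prob_space.prob_space_distr)

lemma reversed_failure_rate_eqD:
  assumes "reversed_failure_rate M X f = reversed_failure_rate N Y g" and "0 < t"
  shows "0 < cdf (distr M borel X) t \<longleftrightarrow> 0 < cdf (distr N borel Y) t"
    and "0 < cdf (distr M borel X) t \<Longrightarrow>
      f t / cdf (distr M borel X) t = g t / cdf (distr N borel Y) t"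
  using fun_cong[OF assms(1), of t] \<open>0 < t\<close>
  by (auto simp: reversed_failure_rate_def Let_def split: if_splits)

text \<open>With the common rate \<open>r = f/F = g/G\<close>, having \<open>F > G > 0\<close>
  forces \<open>f = r F \<ge> r G = g\<close>. The reverse inequality follows by exchanging the two
  variables.\<close>

lemma cdf_le_if_reversed_failure_rate_eq:
  assumes "prob_space M" "prob_space N"
    and g: "\<And>x. 0 \<le> g x"
    and dX: "distributed M lborel X (\<lambda>x. ennreal (f x))"
    and dY: "distributed N lborel Y (\<lambda>x. ennreal (g x))"
    and eq: "reversed_failure_rate M X f = reversed_failure_rate N Y g"
    and "0 < x"
  shows "cdf (distr M borel X) x \<le> cdf (distr N borel Y) x"
proof -
  have meas: "X \<in> borel_measurable M" "Y \<in> borel_measurable N"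
    using distributed_measurable[OF dX] distributed_measurable[OF dY] by simp_all
  have "g t \<le> f t"
    if "x \<le> t" and lt: "cdf (distr N borel Y) t < cdf (distr M borel X) t" for t
  proof -
    let ?F = "cdf (distr M borel X) t" and ?G = "cdf (distr N borel Y) t"
    have "0 < t" using that \<open>0 < x\<close> by simp
    have "0 < ?F" using lt by (rule le_less_trans[rotated]) (simp add: cdf_def)
    \<comment> \<open>Equality of the domains of the two rates gives this; \<open>lt\<close> bounds
      \<open>?G\<close> only from above.\<close>
    have "0 < ?G" using reversed_failure_rate_eqD(1)[OF eq \<open>0 < t\<close>] \<open>0 < ?F\<close> by simp
    have "g t / ?G * ?G \<le> g t / ?G * ?F"
      using lt g[of t] \<open>0 < ?G\<close> by (intro mult_left_mono) auto
    also have "\<dots> = f t"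
      using reversed_failure_rate_eqD(2)[OF eq \<open>0 < t\<close> \<open>0 < ?F\<close>] \<open>0 < ?F\<close>
      by (simp add: field_simps)
    finally show ?thesis using \<open>0 < ?G\<close> by simp
  qed
  then show ?thesis
    using real_distribution_distr_borel[OF assms(1) meas(1)]
      real_distribution_distr_borel[OF assms(2) meas(2)]
      distributed_borel_measurable[OF dX] distributed_borel_measurable[OF dY]
    unfolding distr_borel_eq_density[OF dX] distr_borel_eq_density[OF dY]
    by (intro cdf_le_if_density_ge_where_above) (auto intro: ennreal_leI)
qed

lemma distr_eq_if_reversed_failure_rate_eq:
  assumes M: "prob_space M" and N: "prob_space N"
    and X: "AE \<omega> in M. 0 \<le> X \<omega>" and Y: "AE \<omega> in N. 0 \<le> Y \<omega>"
    and f: "\<And>x. 0 \<le> f x" and g: "\<And>x. 0 \<le> g x"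
    and dX: "distributed M lborel X (\<lambda>x. ennreal (f x))"
    and dY: "distributed N lborel Y (\<lambda>x. ennreal (g x))"
    and eq: "reversed_failure_rate M X f = reversed_failure_rate N Y g"
  shows "distr M borel X = distr N borel Y"
proof -
  have meas: "X \<in> borel_measurable M" "Y \<in> borel_measurable N"
    using distributed_measurable[OF dX] distributed_measurable[OF dY] by simp_all
  interpret P: real_distribution "distr M borel X"
    by (rule real_distribution_distr_borel[OF M meas(1)])
  interpret Q: real_distribution "distr N borel Y"
    by (rule real_distribution_distr_borel[OF N meas(2)])
  have pos: "cdf (distr M borel X) t = cdf (distr N borel Y) t" if "0 < t" for t
    using cdf_le_if_reversed_failure_rate_eq[OF M N g dX dY eq that]
      cdf_le_if_reversed_failure_rate_eq[OF N M f dY dX eq[symmetric] that]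
    by (rule antisym)
  \<comment> \<open>The rates live on \<open>t > 0\<close>, so the value at 0 is recovered as a
    right limit.\<close>
  have "cdf (distr M borel X) 0 = cdf (distr N borel Y) 0"
  proof (rule tendsto_unique[OF trivial_limit_at_right_real])
    show "(cdf (distr M borel X) \<longlongrightarrow> cdf (distr M borel X) 0) (at_right 0)"
      using P.cdf_is_right_cont[of 0] by (simp add: continuous_within)
    have "(cdf (distr N borel Y) \<longlongrightarrow> cdf (distr N borel Y) 0) (at_right 0)"
      using Q.cdf_is_right_cont[of 0] by (simp add: continuous_within)
    then show "(cdf (distr M borel X) \<longlongrightarrow> cdf (distr N borel Y) 0) (at_right 0)"
      by (rule Lim_transform_eventually)
        (auto simp: eventually_at_filter pos)
  qed
  then have "cdf (distr M borel X) t = cdf (distr N borel Y) t" for t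
    using pos cdf_eq_zero_if_AE_nonneg[OF X meas(1)] cdf_eq_zero_if_AE_nonneg[OF Y meas(2)]
    by (cases t "0 :: real" rule: linorder_cases) auto
  then show ?thesis
    by (intro cdf_unique) (auto intro: P.real_distribution_axioms Q.real_distribution_axioms)
qed

theorem theorem2p2:
  fixes M :: "'a measure" and N :: "'b measure"
    and X :: "'a \<Rightarrow> real" and Y :: "'b \<Rightarrow> real"
    and f g :: "real \<Rightarrow> real"
  assumes "prob_space M" and "prob_space N"
    and "AE \<omega> in M. 0 \<le> X \<omega>" and "AE \<omega> in N. 0 \<le> Y \<omega>"
    and "\<And>x. 0 \<le> f x" and "\<And>x. 0 \<le> g x"
    and "distributed M lborel X (\<lambda>x. ennreal (f x))"
    and "distributed N lborel Y (\<lambda>x. ennreal (g x))"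
    and "reversed_failure_rate M X f = reversed_failure_rate N Y g"
  shows "\<forall>t>0. t \<in> dom (past_extropy M X f) \<and> t \<in> dom (past_extropy N Y g) \<longrightarrow>
           past_extropy M X f t = past_extropy N Y g t"
proof -
  note dX = assms(7) and dY = assms(8)
  have distr_eq: "distr M borel X = distr N borel Y"
    by (rule distr_eq_if_reversed_failure_rate_eq[OF assms])
  have "AE x in lborel. ennreal (f x) = ennreal (g x)"
  proof (rule sigma_finite_measure.density_unique[OF sigma_finite_lborel])
    show "density lborel (\<lambda>x. ennreal (f x)) = density lborel (\<lambda>x. ennreal (g x))"
      using distr_eq distr_borel_eq_density[OF dX] distr_borel_eq_density[OF dY] by simp
  qed (use distributed_borel_measurable[OF dX] distributed_borel_measurable[OF dY] in simp_all)
  \<comment> \<open>\<open>ennreal\<close> is injective on nonnegative reals.\<close>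
  then have "AE x in lborel. f x = g x"
    by eventually_elim (simp add: assms(5,6))
  then have "(\<integral>\<^sup>+x\<in>{0..t}. ennreal ((f x)\<^sup>2) \<partial>lborel)
      = (\<integral>\<^sup>+x\<in>{0..t}. ennreal ((g x)\<^sup>2) \<partial>lborel)" for t
    by (intro nn_integral_cong_AE) auto
  \<comment> \<open>The partial functions agree entirely, domains and infinite values
    included.\<close>
  then have "past_extropy M X f = past_extropy N Y g"
    by (intro ext) (simp only: past_extropy_def distr_eq)
  then show ?thesis by simp
qed

end
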